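(* Consider the $l$-th MGU layer, $l\in\{1,\dots,L\}$, with parameters $\theta^{(l)}=\{W_f^{(l)},W_{\tilde h}^{(l)},R_f^{(l)},R_{\tilde h}^{(l)},\boldsymbol b_f^{(l)},\boldsymbol b_{\tilde h}^{(l)}\}$, initial hidden states in $\mathcal H_{\mathrm{inv}}^{(l)}=[-1,1]^{n_h^{(l)}}$ and inputs $\tilde{\boldsymbol u}_k^{(l)}\in\tilde{\mathcal U}^{(l)}=[-1,1]^{n_{\tilde u}^{(l)}}$ for all $k\in\mathbb N$. Let $$\bar\sigma_f^{(l)}:=\sigma\left(\left\|\begin{bmatrix}W_f^{(l)} & R_f^{(l)} & \boldsymbol b_f^{(l)}\end{bmatrix}\right\|\right),\qquad \bar\phi_{\tilde h}^{(l)}:=\phi\left(\left\|\begin{bmatrix}W_{\tilde h}^{(l)} & R_{\tilde h}^{(l)} & \boldsymbol b_{\tilde h}^{(l)}\end{bmatrix}\right\|\right).$$ If $$\bar\sigma_f^{(l)}+\big(\bar\sigma_f^{(l)}\big)^2\|R_{\tilde h}^{(l)}\|+\tfrac14\|R_f^{(l)}\|\left(\bar\sigma_f^{(l)}\|R_{\tilde h}^{(l)}\|+\bar\phi_{\tilde h}^{(l)}+1\right)<1,$$ then the layer is $\delta$ISS in $\mathcal H_{\mathrm{inv}}^{(l)}$ with respect to $\tilde{\mathcal U}^{(l)}$.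
   Context: Notation: $\mathbb N$ includes $0$; $\|\cdot\|$ is the infinity norm of vectors and the induced infinity norm of matrices (maximum absolute row sum); $\circ$ is the element-wise product; $\sigma(x)=1/(1+e^{-x})$ and $\phi(x)=\tanh(x)$; bold $\boldsymbol\sigma,\boldsymbol\phi$ denote component-wise application; $\boldsymbol 1_n$ is the all-ones vector; $[A\ B\ C]$ is horizontal concatenation. MGU layer: with hidden state $\boldsymbol h_k^{(l)}\in\mathbb R^{n_h^{(l)}}$ and input $\tilde{\boldsymbol u}_k^{(l)}\in\mathbb R^{n_{\tilde u}^{(l)}}$, the dynamics are $$\boldsymbol f_k^{(l)}=\boldsymbol\sigma(W_f^{(l)}\tilde{\boldsymbol u}_k^{(l)}+R_f^{(l)}\boldsymbol h_k^{(l)}+\boldsymbol b_f^{(l)}),$$ $$\tilde{\boldsymbol h}_k^{(l)}=\boldsymbol\phi(W_{\tilde h}^{(l)}\tilde{\boldsymbol u}_k^{(l)}+R_{\tilde h}^{(l)}(\boldsymbol f_k^{(l)}\circ\boldsymbol h_k^{(l)})+\boldsymbol b_{\tilde h}^{(l)}),$$ $$\boldsymbol h_{k+1}^{(l)}=(\boldsymbol 1_{n_h^{(l)}}-\boldsymbol f_k^{(l)})\circ\boldsymbol h_k^{(l)}+\boldsymbol f_k^{(l)}\circ\tilde{\boldsymbol h}_k^{(l)},$$ where $W_f^{(l)},W_{\tilde h}^{(l)}\in\mathbb R^{n_h^{(l)}\times n_{\tilde u}^{(l)}}$, $R_f^{(l)},R_{\tilde h}^{(l)}\in\mathbb R^{n_h^{(l)}\times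 n_h^{(l)}}$, $\boldsymbol b_f^{(l)},\boldsymbol b_{\tilde h}^{(l)}\in\mathbb R^{n_h^{(l)}}$. Comparison functions: $\gamma:\mathbb R_{\ge0}\to\mathbb R_{\ge0}$ is class $\mathcal K$ if continuous, strictly increasing, $\gamma(0)=0$; class $\mathcal K_\infty$ if moreover $\gamma(r)\to\infty$ as $r\to\infty$. A continuous $\psi:\mathbb R_{\ge0}\times\mathbb N\to\mathbb R_{\ge0}$ is class $\mathcal{KL}$ if $\psi(\cdot,k)\in\mathcal K$ for each fixed $k$ and, for each fixed $r>0$, $\psi(r,k)$ is strictly decreasing to zero as $k\to\infty$. $\delta$ISS: a system $\boldsymbol x_{k+1}=\boldsymbol w(\boldsymbol x_k,\boldsymbol u_k)$ is $\delta$ISS (incrementally input-to-state stable) in a compact forward invariant set $\mathcal X$ with respect to a compact set $\mathcal U$ if there exist $\psi_\delta\in\mathcal{KL}$ and $\gamma_{\delta u}\in\mathcal K_\infty$ such that for any $k\in\mathbb N$, any $\boldsymbol x_0^{\mathrm a},\boldsymbol x_0^{\mathrm b}\in\mathcal X$, and any input sequences $\{\boldsymbol u_z^{\mathrm a}\in\mathcal U\}_{z=0}^{k-1}$, $\{\boldsymbol u_z^{\mathrm b}\in\mathcal U\}_{z=0}^{k-1}$, the corresponding state trajectories satisfy $$\|\boldsymbol x_k^{\mathrm a}-\boldsymbol x_k^{\mathrm b}\|\le\psi_\delta(\|\boldsymbol x_0^{\mathrm a}-\boldsymbol x_0^{\mathrm b}\|,k)+\gamma_{\delta u}\Big(\max_{0\le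 z<k}\|\boldsymbol u_z^{\mathrm a}-\boldsymbol u_z^{\mathrm b}\|\Big),$$ with the maximum over an empty set taken to be $0$. For the MGU layer, $\boldsymbol x_k=\boldsymbol h_k^{(l)}$ and $\boldsymbol u_k=\tilde{\boldsymbol u}_k^{(l)}$. *)

theory Defs
  imports "HOL-Analysis.Analysis"
begin

subsection \<open>Norms and block matrices\<close>

text \<open>Vectors carry the library's \<^const>\<open>infnorm\<close>; on matrices the induced norm is the
  maximum absolute row sum (see \<open>mat_infnorm_eq_induced\<close> below).\<close>

definition mat_infnorm :: "real^'m^'n \<Rightarrow> real" where
  "mat_infnorm A = Max (range (\<lambda>i. \<Sum>j\<in>UNIV. \<bar>A $ i $ j\<bar>))"

lemma infnorm_vec: "infnorm (x :: real^'n) = Max (range (\<lambda>i. \<bar>x $ i\<bar>))"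
proof -
  have "{\<bar>x $ i\<bar> |i. i \<in> UNIV} = range (\<lambda>i. \<bar>x $ i\<bar>)" by auto
  then have "infnorm x = Sup (range (\<lambda>i. \<bar>x $ i\<bar>))" by (simp add: infnorm_cart)
  also have "\<dots> = Max (range (\<lambda>i. \<bar>x $ i\<bar>))" by (rule cSup_eq_Max) auto
  finally show ?thesis .
qed

lemma mat_infnorm_eq_induced:
  fixes A :: "real^'m^'n"
  shows "mat_infnorm A = Sup {infnorm (A *v x) |x. infnorm x \<le> 1}"
proof -
  obtain i where i: "mat_infnorm A = (\<Sum>j\<in>UNIV. \<bar>A $ i $ j\<bar>)"
  proof -
    have "mat_infnorm A \<in> range (\<lambda>i. \<Sum>j\<in>UNIV. \<bar>A $ i $ j\<bar>)"
      unfolding mat_infnorm_def by (rule Max_in) auto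
    then show ?thesis using that by auto
  qed
  have upper: "infnorm (A *v x) \<le> mat_infnorm A" if x: "infnorm x \<le> 1" for x
  proof -
    have "\<bar>(A *v x) $ k\<bar> \<le> mat_infnorm A" for k
    proof -
      have xj: "\<bar>x $ j\<bar> \<le> 1" for j
        using component_le_infnorm_cart[of x j] x by linarith
      have "\<bar>(A *v x) $ k\<bar> \<le> (\<Sum>j\<in>UNIV. \<bar>A $ k $ j * x $ j\<bar>)"
        by (simp add: matrix_vector_mult_def sum_abs)
      also have "\<dots> \<le> (\<Sum>j\<in>UNIV. \<bar>A $ k $ j\<bar>)"
        using xj by (intro sum_mono) (simp add: abs_mult mult_left_le)
      also have "\<dots> \<le> mat_infnorm A"
        unfolding mat_infnorm_def by (rule Max_ge) auto
      finally show ?thesis .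
    qed
    then show ?thesis by (simp add: infnorm_vec)
  qed
  define s :: "real^'m" where "s = (\<chi> j. sgn (A $ i $ j))"
  have s: "infnorm s \<le> 1" by (simp add: infnorm_vec s_def abs_sgn_eq)
  have "mat_infnorm A = \<bar>(A *v s) $ i\<bar>"
    by (simp add: i s_def matrix_vector_mult_def abs_sgn[symmetric] sum_nonneg)
  also have "\<dots> \<le> infnorm (A *v s)" by (rule component_le_infnorm_cart)
  finally have "infnorm (A *v s) = mat_infnorm A" using upper[OF s] by linarith
  then have "mat_infnorm A \<in> {infnorm (A *v x) |x. infnorm x \<le> 1}"
    using s by (intro CollectI exI[of _ s]) simp
  then show ?thesis
    using upper by (intro cSup_eq_maximum[symmetric]) auto
qed

definition hconcat :: "real^'a^'n \<Rightarrow> real^'b^'n \<Rightarrow> real^('a + 'b)^'n" where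
  "hconcat A B = (\<chi> i j. case j of Inl p \<Rightarrow> A $ i $ p | Inr q \<Rightarrow> B $ i $ q)"

definition block_row :: "real^'m^'n \<Rightarrow> real^'n^'n \<Rightarrow> real^'n \<Rightarrow> real^('m + ('n + 1))^'n" where
  "block_row W R b = hconcat W (hconcat R (columnvector b))"

subsection \<open>Comparison functions and incremental input-to-state stability\<close>

text \<open>Functions on the nonnegative reals are represented by total functions on \<^typ>\<open>real\<close>
  of which only the values on \<open>{0..}\<close> matter.\<close>

definition class_K :: "(real \<Rightarrow> real) \<Rightarrow> bool" where
  "class_K \<gamma> \<longleftrightarrow> continuous_on {0..} \<gamma> \<and> strict_mono_on {0..} \<gamma> \<and> \<gamma> 0 = 0"

definition class_K_inf :: "(real \<Rightarrow> real) \<Rightarrow> bool" where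
  "class_K_inf \<gamma> \<longleftrightarrow> class_K \<gamma> \<and> filterlim \<gamma> at_top at_top"

definition class_KL :: "(real \<Rightarrow> nat \<Rightarrow> real) \<Rightarrow> bool" where
  "class_KL \<psi> \<longleftrightarrow>
     continuous_on ({0..} \<times> UNIV) (\<lambda>(r, k). \<psi> r k) \<and>
     (\<forall>k. class_K (\<lambda>r. \<psi> r k)) \<and>
     (\<forall>r>0. (\<forall>j k. j < k \<longrightarrow> \<psi> r k < \<psi> r j) \<and> (\<lambda>k. \<psi> r k) \<longlonglongrightarrow> 0)"

primrec trajectory :: "('x \<Rightarrow> 'u \<Rightarrow> 'x) \<Rightarrow> 'x \<Rightarrow> (nat \<Rightarrow> 'u) \<Rightarrow> nat \<Rightarrow> 'x" where
  "trajectory w x0 u 0 = x0"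
| "trajectory w x0 u (Suc k) = w (trajectory w x0 u k) (u k)"

definition forward_invariant :: "('x \<Rightarrow> 'u \<Rightarrow> 'x) \<Rightarrow> 'x set \<Rightarrow> 'u set \<Rightarrow> bool" where
  "forward_invariant w X U \<longleftrightarrow> (\<forall>x\<in>X. \<forall>u\<in>U. w x u \<in> X)"

text \<open>Input sequences of length \<open>k\<close> are total sequences constrained only before \<open>k\<close>.
  All norms are nonnegative, so inserting \<open>0\<close> below only fixes the maximum for \<open>k = 0\<close>.\<close>

definition delta_ISS ::
  "('x::euclidean_space \<Rightarrow> 'u::euclidean_space \<Rightarrow> 'x) \<Rightarrow> 'x set \<Rightarrow> 'u set \<Rightarrow> bool" where
  "delta_ISS w X U \<longleftrightarrow>
     compact X \<and> compact U \<and> forward_invariant w X U \<and>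
     (\<exists>\<psi> \<gamma>. class_KL \<psi> \<and> class_K_inf \<gamma> \<and>
        (\<forall>k. \<forall>xa\<in>X. \<forall>xb\<in>X. \<forall>ua ub.
           (\<forall>z<k. ua z \<in> U) \<longrightarrow> (\<forall>z<k. ub z \<in> U) \<longrightarrow>
           infnorm (trajectory w xa ua k - trajectory w xb ub k)
             \<le> \<psi> (infnorm (xa - xb)) k
               + \<gamma> (Max (insert 0 ((\<lambda>z. infnorm (ua z - ub z)) ` {..<k})))))"

subsection \<open>The MGU layer\<close>

definition sigmoid :: "real \<Rightarrow> real" where
  "sigmoid x = 1 / (1 + exp (- x))"

definition vmap :: "(real \<Rightarrow> real) \<Rightarrow> real^'n \<Rightarrow> real^'n" where
  "vmap g v = (\<chi> i. g (v $ i))"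

text \<open>The index type \<open>'n\<close> is for the hidden state and \<open>'m\<close> for the input; the suffix
  \<open>h\<close> marks the parameters of the candidate state.\<close>

record ('n, 'm) mgu =
  Wf :: "real^'m^'n"
  Wh :: "real^'m^'n"
  Rf :: "real^'n^'n"
  Rh :: "real^'n^'n"
  bf :: "real^'n"
  bh :: "real^'n"

text \<open>On \<^typ>\<open>real^'n\<close>, \<open>*\<close> is the element-wise product and \<open>1\<close> the all-ones vector.\<close>

definition mgu_gate :: "('n::finite, 'm::finite) mgu \<Rightarrow> real^'n \<Rightarrow> real^'m \<Rightarrow> real^'n" where
  "mgu_gate \<theta> h u = vmap sigmoid (Wf \<theta> *v u + Rf \<theta> *v h + bf \<theta>)"

definition mgu_candidate :: "('n::finite, 'm::finite) mgu \<Rightarrow> real^'n \<Rightarrow> real^'m \<Rightarrow> real^'n" where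
  "mgu_candidate \<theta> h u = vmap tanh (Wh \<theta> *v u + Rh \<theta> *v (mgu_gate \<theta> h u * h) + bh \<theta>)"

definition mgu_step :: "('n::finite, 'm::finite) mgu \<Rightarrow> real^'n \<Rightarrow> real^'m \<Rightarrow> real^'n" where
  "mgu_step \<theta> h u = (1 - mgu_gate \<theta> h u) * h + mgu_gate \<theta> h u * mgu_candidate \<theta> h u"

definition sigma_bar :: "('n::finite, 'm::finite) mgu \<Rightarrow> real" where
  "sigma_bar \<theta> = sigmoid (mat_infnorm (block_row (Wf \<theta>) (Rf \<theta>) (bf \<theta>)))"

definition phi_bar :: "('n::finite, 'm::finite) mgu \<Rightarrow> real" where
  "phi_bar \<theta> = tanh (mat_infnorm (block_row (Wh \<theta>) (Rh \<theta>) (bh \<theta>)))"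

end

theory Submission
  imports Defs
begin

text \<open>
  The theorem holds because the layer is a uniform contraction in the state, up to a term
  proportional to the input difference. Write \<open>f\<close> for the gate, \<open>c\<close> for the candidate
  state and \<open>a\<close>, \<open>b\<close> for two trajectories. Then
  \<open>h\<^sub>a' - h\<^sub>b' = (1 - f\<^sub>a) (h\<^sub>a - h\<^sub>b) + f\<^sub>a (c\<^sub>a - c\<^sub>b) + (f\<^sub>a - f\<^sub>b) (c\<^sub>b - h\<^sub>b)\<close>,
  where the prime marks the successor state.
  On the unit box every pre-activation is bounded by the norm of its block row, so
  \<open>f\<^sub>a\<close> and (because \<open>1 - \<sigma> x = \<sigma> (- x)\<close>) also \<open>1 - f\<^sub>a\<close> are at most
  \<open>sigma_bar\<close>, while \<open>\<bar>c\<^sub>b\<bar>\<close> is at most \<open>phi_bar\<close>. The sigmoid is Lipschitz with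
  constant \<open>1/4\<close> and \<open>tanh\<close> with constant \<open>1\<close>; splitting also
  \<open>f\<^sub>a h\<^sub>a - f\<^sub>b h\<^sub>b = f\<^sub>a (h\<^sub>a - h\<^sub>b) + (f\<^sub>a - f\<^sub>b) h\<^sub>b\<close> inside the candidate, the
  coefficient of the state difference adds up to exactly the left-hand side of the hypothesis
  (\<open>mgu_step_contracting\<close>). Iterating a contraction with factor \<open>q < 1\<close> gives the
  comparison functions \<open>q ^ k * r\<close> and \<open>C * r\<close>, where \<open>C\<close> comes from a geometric
  series (\<open>delta_ISS_if_contracting\<close>).
\<close>

section \<open>Contractions with inputs are incrementally input-to-state stable\<close>

lemma class_K_inf_linear:
  assumes "C > 0"
  shows "class_K_inf (\<lambda>r. C * r)"
  unfolding class_K_inf_def class_K_def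
  by (intro conjI continuous_on_mult_left continuous_on_id strict_mono_onI mult_zero_right
      mult_strict_left_mono assms filterlim_tendsto_pos_mult_at_top[OF tendsto_const assms]
      filterlim_ident)

lemma class_KL_geometric:
  fixes q :: real
  assumes q: "0 < q" "q < 1"
  shows "class_KL (\<lambda>r k. q ^ k * r)"
  unfolding class_KL_def
proof (intro conjI allI impI)
  have "continuous_on UNIV (\<lambda>k::nat. q ^ k)"
    by simp
  then have "continuous_on ({0..} \<times> UNIV) (\<lambda>p :: real \<times> nat. q ^ snd p)"
    by (rule continuous_on_compose2) (auto intro!: continuous_intros)
  then show "continuous_on ({0..} \<times> UNIV) (\<lambda>(r :: real, k). q ^ k * r)"
    unfolding case_prod_beta by (intro continuous_on_mult continuous_on_fst continuous_on_id)
next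
  show "class_K (\<lambda>r. q ^ k * r)" for k
    using q class_K_inf_linear[of "q ^ k"] by (simp add: class_K_inf_def)
next
  show "q ^ k * r < q ^ j * r" if "r > 0" "j < k" for r and j k :: nat
    using q that by (simp add: power_strict_decreasing)
next
  show "(\<lambda>k. q ^ k * r) \<longlonglongrightarrow> 0" for r
    using q by (intro tendsto_mult_left_zero LIMSEQ_power_zero) simp
qed

lemma trajectory_in_invariant:
  assumes "forward_invariant w X U" "x \<in> X" "\<forall>z<k. u z \<in> U"
  shows "trajectory w x u k \<in> X"
  using assms(3) by (induction k) (use assms(1,2) in \<open>auto simp: forward_invariant_def\<close>)

text \<open>The constant \<open>C = \<mu> / (1 - q)\<close> is the fixed point of \<open>C \<mapsto> q * C + \<mu>\<close>, so the
  input term reproduces itself in the induction.\<close>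

lemma contracting_trajectories:
  fixes w :: "'x::euclidean_space \<Rightarrow> 'u::euclidean_space \<Rightarrow> 'x"
  assumes inv: "forward_invariant w X U"
    and q: "0 \<le> q" "q < 1" and \<mu>: "0 \<le> \<mu>"
    and contr: "\<And>x y u v. \<lbrakk>x \<in> X; y \<in> X; u \<in> U; v \<in> U\<rbrakk> \<Longrightarrow>
      infnorm (w x u - w y v) \<le> q * infnorm (x - y) + \<mu> * infnorm (u - v)"
    and X: "xa \<in> X" "xb \<in> X"
    and U: "\<forall>z<k. ua z \<in> U" "\<forall>z<k. ub z \<in> U"
    and "0 \<le> e" and e: "\<forall>z<k. infnorm (ua z - ub z) \<le> e"
  shows "infnorm (trajectory w xa ua k - trajectory w xb ub k)
    \<le> q ^ k * infnorm (xa - xb) + \<mu> / (1 - q) * e"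
  using U e
proof (induction k)
  case 0
  then show ?case using q \<mu> \<open>0 \<le> e\<close> by simp
next
  case (Suc k)
  let ?d = "\<lambda>k. infnorm (trajectory w xa ua k - trajectory w xb ub k)"
  have IH: "?d k \<le> q ^ k * infnorm (xa - xb) + \<mu> / (1 - q) * e"
    using Suc.prems by (intro Suc.IH) simp_all
  have "?d (Suc k) \<le> q * ?d k + \<mu> * infnorm (ua k - ub k)"
    using Suc.prems X trajectory_in_invariant[OF inv] by (auto intro!: contr)
  also have "\<dots> \<le> q * (q ^ k * infnorm (xa - xb) + \<mu> / (1 - q) * e) + \<mu> * e"
    using Suc.prems(3) by (intro add_mono mult_left_mono IH q(1) \<mu>) simp
  also have "\<dots> = q ^ Suc k * infnorm (xa - xb) + (q * (\<mu> / (1 - q)) + \<mu>) * e"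
    by (simp add: algebra_simps)
  also have "q * (\<mu> / (1 - q)) + \<mu> = \<mu> / (1 - q)"
    using q by (simp add: field_simps)
  finally show ?case .
qed

lemma delta_ISS_if_contracting:
  fixes w :: "'x::euclidean_space \<Rightarrow> 'u::euclidean_space \<Rightarrow> 'x"
  assumes compact: "compact X" "compact U" and inv: "forward_invariant w X U"
    and q: "0 < q" "q < 1" and \<mu>: "0 \<le> \<mu>"
    and contr: "\<And>x y u v. \<lbrakk>x \<in> X; y \<in> X; u \<in> U; v \<in> U\<rbrakk> \<Longrightarrow>
      infnorm (w x u - w y v) \<le> q * infnorm (x - y) + \<mu> * infnorm (u - v)"
  shows "delta_ISS w X U"
proof -
  \<comment> \<open>Adding \<open>1\<close> makes the gain strictly increasing and unbounded even if \<open>\<mu> = 0\<close>.\<close>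
  define C where "C = \<mu> / (1 - q) + 1"
  have C: "C > 0" "\<mu> / (1 - q) \<le> C"
    using q \<mu> by (auto simp: C_def add_nonneg_pos)
  have "infnorm (trajectory w xa ua k - trajectory w xb ub k)
      \<le> q ^ k * infnorm (xa - xb) + C * Max (insert 0 ((\<lambda>z. infnorm (ua z - ub z)) ` {..<k}))"
    (is "_ \<le> _ + C * ?e")
    if "xa \<in> X" "xb \<in> X" "\<forall>z<k. ua z \<in> U" "\<forall>z<k. ub z \<in> U" for k xa xb ua ub
  proof -
    have "0 \<le> ?e" "\<forall>z<k. infnorm (ua z - ub z) \<le> ?e"
      by auto
    then have "infnorm (trajectory w xa ua k - trajectory w xb ub k)
        \<le> q ^ k * infnorm (xa - xb) + \<mu> / (1 - q) * ?e"
      by (intro contracting_trajectories[OF inv less_imp_le[OF q(1)] q(2) \<mu> contr that])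
    also have "\<dots> \<le> q ^ k * infnorm (xa - xb) + C * ?e"
      using C \<open>0 \<le> ?e\<close> by (intro add_left_mono mult_right_mono) auto
    finally show ?thesis .
  qed
  then show ?thesis
    unfolding delta_ISS_def
    by (intro conjI compact inv exI[of _ "\<lambda>r k. q ^ k * r"] exI[of _ "\<lambda>r. C * r"]
        class_KL_geometric[OF q] class_K_inf_linear[OF C(1)] allI ballI impI)
qed

section \<open>Activation functions\<close>

lemma tanh_lipschitz: "\<bar>tanh x - tanh y\<bar> \<le> \<bar>x - y\<bar>" for x y :: real
proof -
  have "norm (tanh x - tanh y) \<le> 1 * norm (x - y)"
  proof (rule field_differentiable_bound[of UNIV])
    show "(tanh has_field_derivative 1 - tanh z ^ 2) (at z within UNIV)" for z :: real
      by (auto intro!: derivative_eq_intros)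
    show "norm (1 - tanh z ^ 2) \<le> 1" for z :: real
      using abs_square_le_1[of "tanh z"] tanh_real_bounds[of z] by auto
  qed auto
  then show ?thesis by simp
qed

text \<open>The sigmoid is a rescaled \<open>tanh\<close>, which transfers monotonicity, symmetry and the
  Lipschitz bound; the two factors \<open>1/2\<close> yield the constant \<open>1/4\<close>.\<close>

lemma sigmoid_tanh: "sigmoid x = (1 + tanh (x / 2)) / 2"
proof -
  have "1 + exp (- x) > 0" by (simp add: add_pos_pos)
  then show ?thesis by (simp add: sigmoid_def tanh_real_altdef divide_simps)
qed

lemma sigmoid_lipschitz: "\<bar>sigmoid x - sigmoid y\<bar> \<le> \<bar>x - y\<bar> / 4"
proof -
  have "\<bar>sigmoid x - sigmoid y\<bar> = \<bar>tanh (x / 2) - tanh (y / 2)\<bar> / 2"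
    by (simp add: sigmoid_tanh flip: diff_divide_distrib)
  also have "\<dots> \<le> \<bar>x / 2 - y / 2\<bar> / 2"
    by (intro divide_right_mono tanh_lipschitz) simp
  also have "\<dots> = \<bar>x - y\<bar> / 4"
    by (simp flip: diff_divide_distrib)
  finally show ?thesis .
qed

lemma sigmoid_pos: "0 < sigmoid x"
  using tanh_real_bounds[of "x / 2"] by (simp add: sigmoid_tanh)

lemma one_minus_sigmoid: "1 - sigmoid x = sigmoid (- x)"
  by (simp add: sigmoid_tanh field_simps)

lemma sigmoid_mono: "x \<le> y \<Longrightarrow> sigmoid x \<le> sigmoid y"
  by (simp add: sigmoid_tanh)

lemma abs_tanh_le: "\<bar>x\<bar> \<le> y \<Longrightarrow> \<bar>tanh x\<bar> \<le> tanh y" for x y :: real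
  by (metis tanh_real_abs tanh_real_le_iff)

section \<open>Bounds through the maximum absolute row sum\<close>

lemma infnorm_leI: "(\<And>i. \<bar>x $ i\<bar> \<le> c) \<Longrightarrow> infnorm x \<le> c" for x :: "real^'n"
  by (simp add: infnorm_vec)

lemma row_sum_le_mat_infnorm: "(\<Sum>j\<in>UNIV. \<bar>A $ i $ j\<bar>) \<le> mat_infnorm A"
  unfolding mat_infnorm_def by (rule Max_ge) auto

lemma mat_infnorm_nonneg: "0 \<le> mat_infnorm A"
  by (rule order_trans[OF sum_nonneg row_sum_le_mat_infnorm]) simp

lemma abs_mat_vec_le_row_sum:
  fixes A :: "real^'m^'n"
  assumes "\<And>j. \<bar>x $ j\<bar> \<le> c"
  shows "\<bar>(A *v x) $ i\<bar> \<le> (\<Sum>j\<in>UNIV. \<bar>A $ i $ j\<bar>) * c"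
proof -
  have "\<bar>(A *v x) $ i\<bar> \<le> (\<Sum>j\<in>UNIV. \<bar>A $ i $ j * x $ j\<bar>)"
    by (simp add: matrix_vector_mult_def sum_abs)
  also have "\<dots> \<le> (\<Sum>j\<in>UNIV. \<bar>A $ i $ j\<bar> * c)"
    using assms by (intro sum_mono) (simp add: abs_mult mult_left_mono)
  finally show ?thesis by (simp add: sum_distrib_right)
qed

lemma abs_mat_vec_le:
  fixes A :: "real^'m^'n"
  assumes "\<And>j. \<bar>x $ j\<bar> \<le> c"
  shows "\<bar>(A *v x) $ i\<bar> \<le> mat_infnorm A * c"
proof -
  have "0 \<le> c" using assms[of undefined] by linarith
  with abs_mat_vec_le_row_sum[of x c A i] assms row_sum_le_mat_infnorm[of A i] show ?thesis
    by (meson mult_right_mono order_trans)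
qed

lemma row_sum_block_row:
  "(\<Sum>j\<in>UNIV. \<bar>block_row W R b $ i $ j\<bar>)
    = (\<Sum>j\<in>UNIV. \<bar>W $ i $ j\<bar>) + (\<Sum>j\<in>UNIV. \<bar>R $ i $ j\<bar>) + \<bar>b $ i\<bar>"
  by (simp add: block_row_def hconcat_def columnvector_def UNIV_Plus_UNIV[symmetric] sum.Plus
      del: UNIV_Plus_UNIV)

lemma abs_affine_le_block_row:
  assumes "\<And>j. \<bar>u $ j\<bar> \<le> 1" "\<And>j. \<bar>h $ j\<bar> \<le> 1"
  shows "\<bar>(W *v u + R *v h + b) $ i\<bar> \<le> mat_infnorm (block_row W R b)"
proof -
  have "\<bar>(W *v u + R *v h + b) $ i\<bar> \<le> \<bar>(W *v u) $ i\<bar> + \<bar>(R *v h) $ i\<bar> + \<bar>b $ i\<bar>"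
    unfolding vector_add_component
    by (intro order_trans[OF abs_triangle_ineq] add_right_mono abs_triangle_ineq)
  also have "\<dots> \<le> (\<Sum>j\<in>UNIV. \<bar>W $ i $ j\<bar>) * 1 + (\<Sum>j\<in>UNIV. \<bar>R $ i $ j\<bar>) * 1 + \<bar>b $ i\<bar>"
    by (intro add_mono abs_mat_vec_le_row_sum assms order_refl)
  also have "\<dots> \<le> mat_infnorm (block_row W R b)"
    using row_sum_le_mat_infnorm[of "block_row W R b" i] unfolding row_sum_block_row mult_1_right .
  finally show ?thesis .
qed

text \<open>Differences of pre-activations lose the bias, so the block row is replaced by the norms
  of its separate blocks.\<close>

lemma abs_affine_diff_le:
  fixes W :: "real^'m^'n" and R :: "real^'n^'n"
  assumes "\<And>j. \<bar>u $ j - u' $ j\<bar> \<le> e" "\<And>j. \<bar>h $ j - h' $ j\<bar> \<le> d"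
  shows "\<bar>(W *v u + R *v h + b) $ i - (W *v u' + R *v h' + b) $ i\<bar>
    \<le> mat_infnorm W * e + mat_infnorm R * d"
proof -
  have "\<bar>(W *v u + R *v h + b) $ i - (W *v u' + R *v h' + b) $ i\<bar>
      = \<bar>(W *v (u - u')) $ i + (R *v (h - h')) $ i\<bar>"
    by (simp add: matrix_vector_mult_diff_distrib)
  also have "\<bar>(W *v (u - u')) $ i + (R *v (h - h')) $ i\<bar>
      \<le> mat_infnorm W * e + mat_infnorm R * d"
    by (intro order_trans[OF abs_triangle_ineq] add_mono abs_mat_vec_le)
      (simp_all only: vector_minus_component assms)
  finally show ?thesis .
qed

lemma mem_unit_cbox: "x \<in> cbox (- 1) 1 \<longleftrightarrow> (\<forall>i. \<bar>x $ i\<bar> \<le> 1)" for x :: "real^'n"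
  by (auto simp: mem_box_cart abs_le_iff minus_le_iff)

lemma abs_le_1_if_mem_unit_cbox: "x \<in> cbox (- 1) 1 \<Longrightarrow> \<bar>x $ i\<bar> \<le> 1" for x :: "real^'n"
  by (simp only: mem_unit_cbox)

section \<open>Contraction of the MGU layer\<close>

text \<open>The bound on \<open>1 - f\<close> is the reason why \<open>sigma_bar\<close>, and not \<open>1\<close>, multiplies the
  old state in the contraction factor.\<close>

lemma mgu_gate_bounds:
  assumes "\<And>j. \<bar>h $ j\<bar> \<le> 1" "\<And>j. \<bar>u $ j\<bar> \<le> 1"
  shows "0 < mgu_gate \<theta> h u $ i" "mgu_gate \<theta> h u $ i \<le> sigma_bar \<theta>"
    "0 < 1 - mgu_gate \<theta> h u $ i" "1 - mgu_gate \<theta> h u $ i \<le> sigma_bar \<theta>"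
proof -
  let ?a = "(Wf \<theta> *v u + Rf \<theta> *v h + bf \<theta>) $ i"
  have gate: "mgu_gate \<theta> h u $ i = sigmoid ?a"
    by (simp only: mgu_gate_def vmap_def vec_lambda_beta)
  have a: "\<bar>?a\<bar> \<le> mat_infnorm (block_row (Wf \<theta>) (Rf \<theta>) (bf \<theta>))"
    by (intro abs_affine_le_block_row assms)
  show "0 < mgu_gate \<theta> h u $ i" "0 < 1 - mgu_gate \<theta> h u $ i"
    by (simp_all only: gate one_minus_sigmoid sigmoid_pos)
  show "mgu_gate \<theta> h u $ i \<le> sigma_bar \<theta>" "1 - mgu_gate \<theta> h u $ i \<le> sigma_bar \<theta>"
    unfolding gate one_minus_sigmoid sigma_bar_def
    by (intro sigmoid_mono order_trans[OF abs_ge_self a] order_trans[OF abs_ge_minus_self a])+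
qed

lemma abs_gated_state_le_1:
  assumes "\<And>j. \<bar>h $ j\<bar> \<le> 1" "\<And>j. \<bar>u $ j\<bar> \<le> 1"
  shows "\<bar>(mgu_gate \<theta> h u * h) $ i\<bar> \<le> 1"
proof -
  have "\<bar>mgu_gate \<theta> h u $ i\<bar> \<le> 1"
    using mgu_gate_bounds(1,3)[OF assms, of \<theta> i] by linarith
  then show ?thesis
    unfolding vector_mult_component abs_mult by (intro mult_le_one assms abs_ge_zero)
qed

lemma abs_mgu_candidate_le:
  assumes "\<And>j. \<bar>h $ j\<bar> \<le> 1" "\<And>j. \<bar>u $ j\<bar> \<le> 1"
  shows "\<bar>mgu_candidate \<theta> h u $ i\<bar> \<le> phi_bar \<theta>"
  unfolding mgu_candidate_def vmap_def phi_bar_def vec_lambda_beta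
  by (intro abs_tanh_le abs_affine_le_block_row abs_gated_state_le_1 assms)

lemma phi_bar_less_1: "phi_bar \<theta> < 1"
  by (simp add: phi_bar_def tanh_real_lt_1)

text \<open>Each component of the new state is a convex combination of numbers in \<open>[-1, 1]\<close>.\<close>

lemma mgu_step_forward_invariant:
  fixes \<theta> :: "('n::finite, 'm::finite) mgu"
  shows "forward_invariant (mgu_step \<theta>) (cbox (- 1) 1) (cbox (- 1) 1)"
  unfolding forward_invariant_def mem_unit_cbox
proof (intro ballI allI)
  fix h :: "real^'n" and u :: "real^'m" and i
  assume box: "h \<in> cbox (- 1) 1" "u \<in> cbox (- 1) 1"
  note hu = box[THEN abs_le_1_if_mem_unit_cbox]
  define f c where "f = mgu_gate \<theta> h u $ i" and "c = mgu_candidate \<theta> h u $ i"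
  have f: "0 \<le> f" "0 \<le> 1 - f"
    using mgu_gate_bounds[OF hu, of \<theta> i] by (auto simp: f_def)
  have c: "\<bar>c\<bar> \<le> 1"
    using abs_mgu_candidate_le[OF hu, of \<theta> i] phi_bar_less_1[of \<theta>] by (simp add: c_def)
  have "\<bar>mgu_step \<theta> h u $ i\<bar> = \<bar>(1 - f) * h $ i + f * c\<bar>"
    by (simp add: mgu_step_def f_def c_def)
  also have "\<dots> \<le> (1 - f) * \<bar>h $ i\<bar> + f * \<bar>c\<bar>"
    using f by (intro order_trans[OF abs_triangle_ineq]) (simp add: abs_mult)
  also have "\<dots> \<le> (1 - f) * 1 + f * 1"
    by (intro add_mono mult_left_mono f c hu)
  finally show "\<bar>mgu_step \<theta> h u $ i\<bar> \<le> 1" by simp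
qed

lemma mgu_step_contracting:
  fixes \<theta> :: "('n::finite, 'm::finite) mgu"
  defines "s \<equiv> sigma_bar \<theta>" and "p \<equiv> phi_bar \<theta>"
    and "r\<^sub>f \<equiv> mat_infnorm (Rf \<theta>)" and "r\<^sub>h \<equiv> mat_infnorm (Rh \<theta>)"
    and "w\<^sub>f \<equiv> mat_infnorm (Wf \<theta>)" and "w\<^sub>h \<equiv> mat_infnorm (Wh \<theta>)"
  assumes box: "ha \<in> cbox (- 1) 1" "hb \<in> cbox (- 1) 1" "ua \<in> cbox (- 1) 1" "ub \<in> cbox (- 1) 1"
  shows "infnorm (mgu_step \<theta> ha ua - mgu_step \<theta> hb ub)
    \<le> (s + s\<^sup>2 * r\<^sub>h + 1 / 4 * r\<^sub>f * (s * r\<^sub>h + p + 1)) * infnorm (ha - hb)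
      + (s * w\<^sub>h + 1 / 4 * w\<^sub>f * (s * r\<^sub>h + p + 1)) * infnorm (ua - ub)"
proof (rule infnorm_leI)
  fix i
  define d e where "d = infnorm (ha - hb)" and "e = infnorm (ua - ub)"
  \<comment> \<open>The gate differs by at most this much in every component;
    \<open>1/4\<close> is the Lipschitz constant of the sigmoid.\<close>
  define g where "g = (w\<^sub>f * e + r\<^sub>f * d) / 4"
  note ha = abs_le_1_if_mem_unit_cbox[OF box(1)] and hb = abs_le_1_if_mem_unit_cbox[OF box(2)]
    and ua = abs_le_1_if_mem_unit_cbox[OF box(3)] and ub = abs_le_1_if_mem_unit_cbox[OF box(4)]
  have d: "\<bar>ha $ j - hb $ j\<bar> \<le> d" for j
    using component_le_infnorm_cart[of "ha - hb" j] by (simp add: d_def)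
  have e: "\<bar>ua $ j - ub $ j\<bar> \<le> e" for j
    using component_le_infnorm_cart[of "ua - ub" j] by (simp add: e_def)
  have nonneg: "0 \<le> d" "0 \<le> e" "0 \<le> s" "0 \<le> g" "0 \<le> r\<^sub>h" "0 \<le> w\<^sub>h"
    by (simp_all add: d_def e_def s_def g_def r\<^sub>f_def r\<^sub>h_def w\<^sub>f_def w\<^sub>h_def sigma_bar_def
        infnorm_pos_le mat_infnorm_nonneg sigmoid_pos less_imp_le)
  define fa fb ca cb where
    "fa = mgu_gate \<theta> ha ua" and "fb = mgu_gate \<theta> hb ub" and
    "ca = mgu_candidate \<theta> ha ua" and "cb = mgu_candidate \<theta> hb ub"
  have fa: "\<bar>fa $ j\<bar> \<le> s" "\<bar>1 - fa $ j\<bar> \<le> s" for j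
    using mgu_gate_bounds[OF ha ua, of \<theta> j] by (auto simp: fa_def s_def)
  have f_diff: "\<bar>fa $ j - fb $ j\<bar> \<le> g" for j
  proof -
    have "\<bar>fa $ j - fb $ j\<bar> \<le> \<bar>(Wf \<theta> *v ua + Rf \<theta> *v ha + bf \<theta>) $ j
        - (Wf \<theta> *v ub + Rf \<theta> *v hb + bf \<theta>) $ j\<bar> / 4"
      unfolding fa_def fb_def mgu_gate_def vmap_def vec_lambda_beta by (rule sigmoid_lipschitz)
    also have "\<dots> \<le> g"
      unfolding g_def w\<^sub>f_def r\<^sub>f_def
      by (intro divide_right_mono abs_affine_diff_le d e) simp
    finally show ?thesis .
  qed
  have fh_diff: "\<bar>(fa * ha) $ j - (fb * hb) $ j\<bar> \<le> s * d + g" for j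
  proof -
    have gated_diff: "(fa * ha) $ j - (fb * hb) $ j
        = fa $ j * (ha $ j - hb $ j) + (fa $ j - fb $ j) * hb $ j"
      by (simp add: algebra_simps)
    have "\<bar>(fa * ha) $ j - (fb * hb) $ j\<bar>
        \<le> \<bar>fa $ j\<bar> * \<bar>ha $ j - hb $ j\<bar> + \<bar>fa $ j - fb $ j\<bar> * \<bar>hb $ j\<bar>"
      unfolding gated_diff abs_mult[symmetric] by (rule abs_triangle_ineq)
    also have "\<dots> \<le> s * d + g * 1"
      by (intro add_mono mult_mono fa d f_diff hb nonneg abs_ge_zero)
    finally show ?thesis by simp
  qed
  have c_diff: "\<bar>ca $ i - cb $ i\<bar> \<le> w\<^sub>h * e + r\<^sub>h * (s * d + g)"
  proof -
    have "\<bar>ca $ i - cb $ i\<bar> \<le> \<bar>(Wh \<theta> *v ua + Rh \<theta> *v (fa * ha) + bh \<theta>) $ i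
        - (Wh \<theta> *v ub + Rh \<theta> *v (fb * hb) + bh \<theta>) $ i\<bar>"
      unfolding ca_def cb_def fa_def fb_def mgu_candidate_def vmap_def vec_lambda_beta
      by (rule tanh_lipschitz)
    also have "\<dots> \<le> w\<^sub>h * e + r\<^sub>h * (s * d + g)"
      unfolding w\<^sub>h_def r\<^sub>h_def by (intro abs_affine_diff_le e fh_diff)
    finally show ?thesis .
  qed
  have cb_hb: "\<bar>cb $ i - hb $ i\<bar> \<le> p + 1"
    unfolding cb_def p_def
    by (intro order_trans[OF abs_triangle_ineq4] add_mono abs_mgu_candidate_le hb ub)
  have step_diff: "(mgu_step \<theta> ha ua - mgu_step \<theta> hb ub) $ i
      = (1 - fa $ i) * (ha $ i - hb $ i) + fa $ i * (ca $ i - cb $ i)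
        + (fa $ i - fb $ i) * (cb $ i - hb $ i)"
    by (simp add: mgu_step_def fa_def fb_def ca_def cb_def algebra_simps)
  have "\<bar>(mgu_step \<theta> ha ua - mgu_step \<theta> hb ub) $ i\<bar>
      \<le> \<bar>1 - fa $ i\<bar> * \<bar>ha $ i - hb $ i\<bar> + \<bar>fa $ i\<bar> * \<bar>ca $ i - cb $ i\<bar>
        + \<bar>fa $ i - fb $ i\<bar> * \<bar>cb $ i - hb $ i\<bar>"
    unfolding step_diff abs_mult[symmetric]
    by (intro order_trans[OF abs_triangle_ineq] add_right_mono abs_triangle_ineq)
  also have "\<dots> \<le> s * d + s * (w\<^sub>h * e + r\<^sub>h * (s * d + g)) + g * (p + 1)"
    by (intro add_mono mult_mono fa d c_diff f_diff cb_hb nonneg abs_ge_zero)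
  also have "\<dots> = (s + s\<^sup>2 * r\<^sub>h + 1 / 4 * r\<^sub>f * (s * r\<^sub>h + p + 1)) * d
      + (s * w\<^sub>h + 1 / 4 * w\<^sub>f * (s * r\<^sub>h + p + 1)) * e"
    by (simp add: g_def field_simps power2_eq_square)
  finally show "\<bar>(mgu_step \<theta> ha ua - mgu_step \<theta> hb ub) $ i\<bar>
    \<le> (s + s\<^sup>2 * r\<^sub>h + 1 / 4 * r\<^sub>f * (s * r\<^sub>h + p + 1)) * infnorm (ha - hb)
      + (s * w\<^sub>h + 1 / 4 * w\<^sub>f * (s * r\<^sub>h + p + 1)) * infnorm (ua - ub)"
    by (simp only: d_def e_def)
qed

theorem theorem2:
  fixes \<theta> :: "('n::finite, 'm::finite) mgu"
  assumes "sigma_bar \<theta> + (sigma_bar \<theta>)\<^sup>2 * mat_infnorm (Rh \<theta>)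
             + 1 / 4 * mat_infnorm (Rf \<theta>)
                 * (sigma_bar \<theta> * mat_infnorm (Rh \<theta>) + phi_bar \<theta> + 1) < 1"
  shows "delta_ISS (mgu_step \<theta>) (cbox (- 1) 1 :: (real^'n) set) (cbox (- 1) 1 :: (real^'m) set)"
proof (rule delta_ISS_if_contracting[OF compact_cbox compact_cbox mgu_step_forward_invariant
      _ assms _ mgu_step_contracting])
  have s: "0 < sigma_bar \<theta>"
    by (simp add: sigma_bar_def sigmoid_pos)
  have p: "0 \<le> phi_bar \<theta>"
    by (simp add: phi_bar_def mat_infnorm_nonneg)
  show "0 < sigma_bar \<theta> + (sigma_bar \<theta>)\<^sup>2 * mat_infnorm (Rh \<theta>)
      + 1 / 4 * mat_infnorm (Rf \<theta>) * (sigma_bar \<theta> * mat_infnorm (Rh \<theta>) + phi_bar \<theta> + 1)"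
    using s p by (intro add_pos_nonneg mult_nonneg_nonneg add_nonneg_nonneg)
      (auto simp: mat_infnorm_nonneg)
  show "0 \<le> sigma_bar \<theta> * mat_infnorm (Wh \<theta>)
      + 1 / 4 * mat_infnorm (Wf \<theta>) * (sigma_bar \<theta> * mat_infnorm (Rh \<theta>) + phi_bar \<theta> + 1)"
    using s p by (intro add_nonneg_nonneg mult_nonneg_nonneg) (auto simp: mat_infnorm_nonneg)
qed

end
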